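(* Let $G$ be a proper subdomain of $\mathbb{C}^n$ and let $\omega$ be a majorant for which there are constants $\delta_0>0$ and $C>0$ with $$\int_{0}^{\delta}\frac{\omega(t)}{t}\,dt\leq C\omega(\delta),\qquad 0<\delta<\delta_{0}.$$ Let $k\in(0,1)$. If $f\in\mathcal{H}_{k}(G)$, then $$f\in\Lambda_{\omega,\inf}(G)\Longleftrightarrow |f|\in\Lambda_{\omega,\inf}(G).$$
   Context: For $z,w\in\mathbb{C}^n$, $z\cdot w=\sum_{j=1}^n z_j\overline{w}_j$, $|z|=(z\cdot z)^{1/2}$, $\mathbb{B}^n=\{z\in\mathbb{C}^n:|z|<1\}$; $d_G(z)$ is the distance from $z$ to $\partial G$. A continuous complex-valued function $f$ on a domain $G\subset\mathbb{C}^n$ is pluriharmonic if for each $z\in G$ and $\theta\in\partial\mathbb{B}^n$ the function $\zeta\mapsto f(z+\theta\zeta)$ is harmonic in $\{\zeta\in\mathbb{C}:|\zeta|<d_G(z)\}$. Notation: $\nabla f=(f_{z_1},\dots,f_{z_n})$ and $\nabla\overline f=(f_{\overline z_1},\dots,f_{\overline z_n})$. For a proper domain $G$ of $\mathbb{C}^n$ and $k\in(0,1)$, $\mathcal{H}_k(G)$ is the class of all pluriharmonic mappings $f=h+\overline g$ from $G$ into $\mathbb{C}$, with $h,g$ holomorphic in $G$, such that for every $\theta\in\partial\mathbb{B}^n$ and $z\in G$, $|\nabla\overline f(z)\cdot\theta|\le k\,|\nabla f(z)\cdot\overline\theta|$. A majorant is a continuous increasing function $\omega:[0,\infty)\to[0,\infty)$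 with $\omega(0)=0$ such that $\omega(t)/t$ is non-increasing for $t>0$. For $z_1,z_2\in G$ let $$d_{\omega,G}(z_1,z_2)=\inf\int_\gamma\frac{\omega(d_G(z))}{d_G(z)}\,ds(z),$$ where $ds$ is arclength and the infimum is over all rectifiable curves $\gamma\subset G$ joining $z_1$ and $z_2$. A function $f:G\to\mathbb{C}$ belongs to $\Lambda_{\omega,\inf}(G)$ if there is a constant $C>0$, depending only on $f$, such that $|f(z_1)-f(z_2)|\le C\,d_{\omega,G}(z_1,z_2)$ for all $z_1,z_2\in G$. *)

theory Defs
  imports "HOL-Analysis.Analysis"
begin

definition cdot :: "complex ^ 'n \<Rightarrow> complex ^ 'n \<Rightarrow> complex" where
  "cdot z w = (\<Sum>j\<in>UNIV. z $ j * cnj (w $ j))"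

(* The library norm on complex ^ 'n is the one induced by cdot. *)
lemma norm_power2_eq_cdot: "complex_of_real (norm z ^ 2) = cdot z z"
proof -
  have "norm z ^ 2 = (\<Sum>j\<in>UNIV. cmod (z $ j) ^ 2)"
    unfolding norm_vec_def L2_set_def by (rule real_sqrt_pow2) (simp add: sum_nonneg)
  then show ?thesis
    by (simp add: cdot_def complex_norm_square del: of_real_power)
qed

definition vec_cnj :: "complex ^ 'n \<Rightarrow> complex ^ 'n" where
  "vec_cnj z = (\<chi> j. cnj (z $ j))"

definition is_domain :: "'a::real_normed_vector set \<Rightarrow> bool" where
  "is_domain G \<longleftrightarrow> open G \<and> connected G \<and> G \<noteq> {}"

definition bdist :: "'a::real_normed_vector set \<Rightarrow> 'a \<Rightarrow> real" where
  "bdist G z = infdist z (frontier G)"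


section \<open>Pluriharmonic mappings\<close>

(* Twice continuously differentiable with vanishing Laplacian, where ux, uy, uxx, ... are the
   partial derivatives with respect to the real and the imaginary part of the variable. *)
definition harmonic_on :: "(complex \<Rightarrow> complex) \<Rightarrow> complex set \<Rightarrow> bool" where
  "harmonic_on u S \<longleftrightarrow>
    (\<exists>ux uy uxx uxy uyx uyy.
      (\<forall>z\<in>S. (u has_derivative (\<lambda>h. Re h *\<^sub>R ux z + Im h *\<^sub>R uy z)) (at z)
           \<and> (ux has_derivative (\<lambda>h. Re h *\<^sub>R uxx z + Im h *\<^sub>R uxy z)) (at z)
           \<and> (uy has_derivative (\<lambda>h. Re h *\<^sub>R uyx z + Im h *\<^sub>R uyy z)) (at z)
           \<and> uxx z + uyy z = 0)
      \<and> continuous_on S uxx \<and> continuous_on S uxy \<and> continuous_on S uyx \<and> continuous_on S uyy)"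

definition pluriharmonic_on :: "(complex ^ 'n \<Rightarrow> complex) \<Rightarrow> (complex ^ 'n) set \<Rightarrow> bool" where
  "pluriharmonic_on f G \<longleftrightarrow> continuous_on G f \<and>
    (\<forall>z\<in>G. \<forall>\<theta>. norm \<theta> = 1 \<longrightarrow>
      harmonic_on (\<lambda>\<zeta>. f (z + \<zeta> *s \<theta>)) {\<zeta>. cmod \<zeta> < bdist G z})"

(* For open G: the real Frechet derivative exists at every point and is complex linear. *)
definition holomorphic_vec_on :: "(complex ^ 'n \<Rightarrow> complex) \<Rightarrow> (complex ^ 'n) set \<Rightarrow> bool" where
  "holomorphic_vec_on h G \<longleftrightarrow>
    (\<forall>z\<in>G. \<exists>a. (h has_derivative (\<lambda>v. \<Sum>j\<in>UNIV. a $ j * v $ j)) (at z))"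

definition dir_deriv ::
  "complex ^ 'n \<Rightarrow> (complex ^ 'n \<Rightarrow> complex) \<Rightarrow> complex ^ 'n \<Rightarrow> complex" where
  "dir_deriv v f z = vector_derivative (\<lambda>t::real. f (z + t *\<^sub>R v)) (at 0)"

(* With z_j = x_j + i y_j, axis j 1 is the direction of x_j and axis j \<i> that of y_j;
   nabla f collects the Wirtinger derivatives f_(z_j) = (f_(x_j) - i f_(y_j)) / 2 and
   nabla_bar f the derivatives of the same function f with respect to conj z_j. *)
definition nabla :: "(complex ^ 'n \<Rightarrow> complex) \<Rightarrow> complex ^ 'n \<Rightarrow> complex ^ 'n" where
  "nabla f z = (\<chi> j. (dir_deriv (axis j 1) f z - \<i> * dir_deriv (axis j \<i>) f z) / 2)"

definition nabla_bar :: "(complex ^ 'n \<Rightarrow> complex) \<Rightarrow> complex ^ 'n \<Rightarrow> complex ^ 'n" where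
  "nabla_bar f z = (\<chi> j. (dir_deriv (axis j 1) f z + \<i> * dir_deriv (axis j \<i>) f z) / 2)"

definition H_class :: "real \<Rightarrow> (complex ^ 'n) set \<Rightarrow> (complex ^ 'n \<Rightarrow> complex) set" where
  "H_class k G = {f. pluriharmonic_on f G
     \<and> (\<exists>h g. holomorphic_vec_on h G \<and> holomorphic_vec_on g G \<and> (\<forall>z\<in>G. f z = h z + cnj (g z)))
     \<and> (\<forall>\<theta>. norm \<theta> = 1 \<longrightarrow> (\<forall>z\<in>G.
          cmod (cdot (nabla_bar f z) \<theta>) \<le> k * cmod (cdot (nabla f z) (vec_cnj \<theta>))))}"


section \<open>Majorants\<close>

(* Only the values on [0, infinity) matter; increasing is meant in the weak sense. *)
definition majorant :: "(real \<Rightarrow> real) \<Rightarrow> bool" where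
  "majorant \<omega> \<longleftrightarrow> continuous_on {0..} \<omega> \<and> (\<forall>t\<ge>0. 0 \<le> \<omega> t) \<and> mono_on {0..} \<omega> \<and> \<omega> 0 = 0
     \<and> antimono_on {0<..} (\<lambda>t. \<omega> t / t)"


section \<open>Rectifiable curves and integration with respect to arclength\<close>

definition chord_sums :: "(real \<Rightarrow> 'a::real_normed_vector) \<Rightarrow> real \<Rightarrow> real \<Rightarrow> real set" where
  "chord_sums \<gamma> a b =
    {\<Sum>i<m. norm (\<gamma> (t (Suc i)) - \<gamma> (t i)) | (m::nat) t.
       t 0 = a \<and> t m = b \<and> (\<forall>i<m. t i \<le> t (Suc i))}"

definition rectifiable_path :: "(real \<Rightarrow> 'a::real_normed_vector) \<Rightarrow> bool" where
  "rectifiable_path \<gamma> \<longleftrightarrow> path \<gamma> \<and> bdd_above (chord_sums \<gamma> 0 1)"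

(* Length of the restriction of the path to [0, t], extended constantly outside [0, 1]
   so that it can serve as the distribution function of a measure on the line. *)
definition arc_length :: "(real \<Rightarrow> 'a::real_normed_vector) \<Rightarrow> real \<Rightarrow> real" where
  "arc_length \<gamma> t = Sup (chord_sums \<gamma> 0 (max 0 (min 1 t)))"

(* The Stieltjes integral of r along the path with respect to the arc length function, which
   is nondecreasing and continuous for rectifiable paths. *)
definition arc_integral :: "(real \<Rightarrow> 'a::real_normed_vector) \<Rightarrow> ('a \<Rightarrow> real) \<Rightarrow> real" where
  "arc_integral \<gamma> r = (LINT t:{0..1}|interval_measure (arc_length \<gamma>). r (\<gamma> t))"

(* For a domain G and a majorant, the infimum is over a nonempty set of nonnegative reals, and
   the integrands are continuous along the paths, hence integrable. *)
definition d_om ::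
  "(real \<Rightarrow> real) \<Rightarrow> 'a::real_normed_vector set \<Rightarrow> 'a \<Rightarrow> 'a \<Rightarrow> real" where
  "d_om \<omega> G z1 z2 =
    Inf {arc_integral \<gamma> (\<lambda>z. \<omega> (bdist G z) / bdist G z) | \<gamma>.
      rectifiable_path \<gamma> \<and> path_image \<gamma> \<subseteq> G \<and> pathstart \<gamma> = z1 \<and> pathfinish \<gamma> = z2}"

definition Lambda_inf ::
  "(real \<Rightarrow> real) \<Rightarrow> 'a::real_normed_vector set \<Rightarrow> ('a \<Rightarrow> complex) set" where
  "Lambda_inf \<omega> G =
    {f. \<exists>C>0. \<forall>z1\<in>G. \<forall>z2\<in>G. cmod (f z1 - f z2) \<le> C * d_om \<omega> G z1 z2}"

end

theory Submission
  imports Defs "HOL-Complex_Analysis.Cauchy_Integral_Formula"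
begin

text \<open>
  The implication from \<open>f\<close> to \<open>\<bar>f\<bar>\<close> is the reverse triangle inequality. For the converse, write
  \<open>d\<close> for the distance to the boundary and call \<open>\<omega>(d) / d\<close> the weight, so that the metric of the
  statement integrates the weight along curves. The point is that control of \<open>\<bar>f\<bar>\<close> forces a
  pointwise bound of the derivative of \<open>f\<close> by a constant times the weight; integrating this bound
  along curves (\<open>norm_diff_le_d_om_of_derivative\<close>) gives the claim.

  The pointwise bound has two ingredients. First, on the ball of radius \<open>d(z) / 2\<close> about \<open>z\<close> the
  weight is at most its value at distance \<open>d(z) / 2\<close>, because \<open>\<omega>(t) / t\<close> is non-increasing.
  Integrating it along a radius shows that \<open>\<bar>f\<bar>\<close> exceeds \<open>\<bar>f(z)\<bar>\<close> by at most \<open>C \<omega>(d(z))\<close> on this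
  ball (\<open>abs_increment_half_ball\<close>). Second, multiply \<open>f = h + cnj g\<close> by a unimodular constant \<open>c\<close>
  for which \<open>c f(z) = \<bar>f(z)\<bar>\<close>. On every complex line through \<open>z\<close> the real part of \<open>c f\<close> is the
  real part of the holomorphic function \<open>\<Phi> = c h + cnj c g\<close>. It is bounded above by
  \<open>\<bar>f(z)\<bar> + C \<omega>(d(z))\<close> and equals \<open>\<bar>f(z)\<bar>\<close> at the centre, so an estimate of Borel-Caratheodory type
  (\<open>cmod_deriv_le_Re_bound\<close>) bounds the derivative of \<open>\<Phi>\<close> at the centre by a multiple of
  \<open>\<omega>(d(z)) / d(z)\<close>. The condition \<open>\<bar>g'\<bar> \<le> k \<bar>h'\<bar>\<close> prevents cancellation between the two terms:
  \<open>\<bar>\<Phi>'\<bar> \<ge> (1 - k) \<bar>h'\<bar>\<close>, hence \<open>h'\<close>, and with it \<open>g'\<close>, obeys the same bound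
  (\<open>derivative_le_of_abs_bound\<close>).

  The curves are arbitrary rectifiable ones, and arc length enters as a Stieltjes measure. That
  measure has the expected values on intervals only once the arc length function is known to be
  monotone and continuous from the right, which is proved first.
\<close>

section \<open>Arc length as a Stieltjes distribution function\<close>

lemma chord_sumsI:
  assumes "t 0 = a" "t m = b" "\<And>i. i < m \<Longrightarrow> t i \<le> t (Suc i)"
  shows "(\<Sum>i<m. norm (\<gamma> (t (Suc i)) - \<gamma> (t i))) \<in> chord_sums \<gamma> a b"
  using assms unfolding chord_sums_def by blast

lemma partition_bounds:
  fixes t :: "nat \<Rightarrow> real"
  assumes "\<And>i. i < m \<Longrightarrow> t i \<le> t (Suc i)" "i \<le> m"
  shows "t 0 \<le> t i" "t i \<le> t m"
proof -
  have mono: "t i \<le> t j" if "i \<le> j" "j \<le> m" for i j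
    using that
  proof (induction j rule: dec_induct)
    case (step n)
    then show ?case using assms(1)[of n] by simp
  qed simp
  show "t 0 \<le> t i" "t i \<le> t m"
    using mono assms(2) by auto
qed

lemma chord_in_chord_sums:
  assumes "a \<le> b"
  shows "norm (\<gamma> b - \<gamma> a) \<in> chord_sums \<gamma> a b"
  using chord_sumsI[of "\<lambda>i. if i = 0 then a else b" a 1 b \<gamma>] assms by simp

lemma chord_sums_refl: "chord_sums \<gamma> a a = {0}"
proof -
  have "s = 0" if s_in: "s \<in> chord_sums \<gamma> a a" for s
  proof -
    obtain m t where s: "s = (\<Sum>i<m. norm (\<gamma> (t (Suc i)) - \<gamma> (t i)))"
      and t: "t 0 = a" "t m = a" "\<And>i. i < m \<Longrightarrow> t i \<le> t (Suc i)"
      using s_in unfolding chord_sums_def by blast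
    have "t i = a" if "i \<le> m" for i
      using partition_bounds[of m t i] t that by force
    then show ?thesis unfolding s by simp
  qed
  moreover have "0 \<in> chord_sums \<gamma> a a"
    using chord_in_chord_sums[of a a \<gamma>] by simp
  ultimately show ?thesis by blast
qed

text \<open>Together with single chords, this lets every chord sum over a subinterval be completed to one
  over the whole interval, and it gives superadditivity of the variation.\<close>

lemma chord_sums_append:
  assumes "x \<in> chord_sums \<gamma> a b" "y \<in> chord_sums \<gamma> b c"
  shows "x + y \<in> chord_sums \<gamma> a c"
proof -
  obtain m t where x: "x = (\<Sum>i<m. norm (\<gamma> (t (Suc i)) - \<gamma> (t i)))"
    and t: "t 0 = a" "t m = b" "\<And>i. i < m \<Longrightarrow> t i \<le> t (Suc i)"
    using assms(1) unfolding chord_sums_def by blast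
  obtain n s where y: "y = (\<Sum>i<n. norm (\<gamma> (s (Suc i)) - \<gamma> (s i)))"
    and s: "s 0 = b" "s n = c" "\<And>i. i < n \<Longrightarrow> s i \<le> s (Suc i)"
    using assms(2) unfolding chord_sums_def by blast
  define u where "u i = (if i \<le> m then t i else s (i - m))" for i
  have u_hi: "u (m + i) = s i" for i
    using t(2) s(1) by (auto simp: u_def)
  have "u i \<le> u (Suc i)" if "i < m + n" for i
  proof (cases "i < m")
    case True
    then show ?thesis using t(3) by (simp add: u_def)
  next
    case False
    then obtain j where "i = m + j" by (metis add_diff_inverse_nat)
    then show ?thesis
      using s(3)[of j] that u_hi[of j] u_hi[of "Suc j"] by simp
  qed
  moreover have "u 0 = a" "u (m + n) = c"
    using t(1) s(2) u_hi by (simp_all add: u_def)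
  ultimately have "(\<Sum>i<m + n. norm (\<gamma> (u (Suc i)) - \<gamma> (u i))) \<in> chord_sums \<gamma> a c"
    by (intro chord_sumsI)
  moreover have "(\<Sum>i<m + n. norm (\<gamma> (u (Suc i)) - \<gamma> (u i))) = x + y"
  proof -
    have "(\<Sum>i<m + n. norm (\<gamma> (u (Suc i)) - \<gamma> (u i))) =
      (\<Sum>i<m. norm (\<gamma> (u (Suc i)) - \<gamma> (u i))) + (\<Sum>i<n. norm (\<gamma> (u (Suc (m + i))) - \<gamma> (u (m + i))))"
      by (induction n) simp_all
    also have "(\<Sum>i<m. norm (\<gamma> (u (Suc i)) - \<gamma> (u i))) = x"
      unfolding x by (rule sum.cong) (simp_all add: u_def)
    also have "(\<Sum>i<n. norm (\<gamma> (u (Suc (m + i))) - \<gamma> (u (m + i)))) = y"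
      unfolding y using u_hi u_hi[of "Suc _"] by simp
    finally show ?thesis .
  qed
  ultimately show ?thesis by simp
qed

text \<open>Truncating a partition of \<open>[a, c]\<close> by \<open>min\<close> and \<open>max\<close> with \<open>b\<close> gives partitions of
  \<open>[a, b]\<close> and \<open>[b, c]\<close>, and only the step that crosses \<open>b\<close> needs the triangle inequality.\<close>

lemma truncated_chord_sums:
  assumes t: "t 0 = a" "t m = c" "\<And>i. i < m \<Longrightarrow> t i \<le> t (Suc i)" and b: "a \<le> b" "b \<le> c"
  shows "(\<Sum>i<m. norm (\<gamma> (min (t (Suc i)) b) - \<gamma> (min (t i) b))) \<in> chord_sums \<gamma> a b"
    and "(\<Sum>i<m. norm (\<gamma> (max (t (Suc i)) b) - \<gamma> (max (t i) b))) \<in> chord_sums \<gamma> b c"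
    and "(\<Sum>i<m. norm (\<gamma> (t (Suc i)) - \<gamma> (t i)))
      \<le> (\<Sum>i<m. norm (\<gamma> (min (t (Suc i)) b) - \<gamma> (min (t i) b)))
       + (\<Sum>i<m. norm (\<gamma> (max (t (Suc i)) b) - \<gamma> (max (t i) b)))"
proof -
  let ?l = "\<Sum>i<m. norm (\<gamma> (min (t (Suc i)) b) - \<gamma> (min (t i) b))"
  let ?r = "\<Sum>i<m. norm (\<gamma> (max (t (Suc i)) b) - \<gamma> (max (t i) b))"
  show "?l \<in> chord_sums \<gamma> a b"
    by (rule chord_sumsI[where t = "\<lambda>i. min (t i) b"])
       (use t b in \<open>auto simp: min_def intro: order_trans\<close>)
  show "?r \<in> chord_sums \<gamma> b c"
    by (rule chord_sumsI[where t = "\<lambda>i. max (t i) b"])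
       (use t b in \<open>auto simp: max_def intro: order_trans\<close>)
  show "(\<Sum>i<m. norm (\<gamma> (t (Suc i)) - \<gamma> (t i))) \<le> ?l + ?r"
    unfolding sum.distrib[symmetric]
  proof (rule sum_mono)
    fix i assume "i \<in> {..<m}"
    then have le: "t i \<le> t (Suc i)" using t(3) by simp
    have "norm (\<gamma> (t (Suc i)) - \<gamma> (t i)) \<le> norm (\<gamma> b - \<gamma> (t i)) + norm (\<gamma> (t (Suc i)) - \<gamma> b)"
      by (metis add.commute diff_add_cancel add_diff_eq norm_triangle_ineq)
    then show "norm (\<gamma> (t (Suc i)) - \<gamma> (t i))
      \<le> norm (\<gamma> (min (t (Suc i)) b) - \<gamma> (min (t i) b)) + norm (\<gamma> (max (t (Suc i)) b) - \<gamma> (max (t i) b))"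
      using le by (auto simp: min_def max_def)
  qed
qed

definition variation :: "(real \<Rightarrow> 'a::real_normed_vector) \<Rightarrow> real \<Rightarrow> real \<Rightarrow> real" where
  "variation \<gamma> a b = Sup (chord_sums \<gamma> a b)"

lemma arc_length_eq_variation: "arc_length \<gamma> t = variation \<gamma> 0 (max 0 (min 1 t))"
  by (simp add: arc_length_def variation_def)

lemma bdd_above_chord_sums:
  assumes "rectifiable_path \<gamma>" "0 \<le> a" "a \<le> b" "b \<le> 1"
  shows "bdd_above (chord_sums \<gamma> a b)"
proof -
  obtain B where B: "\<And>x. x \<in> chord_sums \<gamma> 0 1 \<Longrightarrow> x \<le> B"
    using assms(1) by (auto simp: rectifiable_path_def bdd_above_def)
  have "x \<le> B" if x: "x \<in> chord_sums \<gamma> a b" for x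
  proof -
    have "norm (\<gamma> a - \<gamma> 0) + x + norm (\<gamma> 1 - \<gamma> b) \<in> chord_sums \<gamma> 0 1"
      by (intro chord_sums_append[OF chord_sums_append[OF _ x]] chord_in_chord_sums assms)
    from B[OF this] show ?thesis
      using norm_ge_zero[of "\<gamma> a - \<gamma> 0"] norm_ge_zero[of "\<gamma> 1 - \<gamma> b"] by linarith
  qed
  then show ?thesis by (auto simp: bdd_above_def)
qed

lemma chord_sum_le_variation:
  assumes "rectifiable_path \<gamma>" "0 \<le> a" "a \<le> b" "b \<le> 1" "x \<in> chord_sums \<gamma> a b"
  shows "x \<le> variation \<gamma> a b"
  unfolding variation_def using assms by (intro cSup_upper bdd_above_chord_sums) auto

lemma norm_diff_le_variation:
  assumes "rectifiable_path \<gamma>" "0 \<le> a" "a \<le> b" "b \<le> 1"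
  shows "norm (\<gamma> b - \<gamma> a) \<le> variation \<gamma> a b"
  using assms by (intro chord_sum_le_variation chord_in_chord_sums)

text \<open>The inequality from left to right comes from truncating partitions, the other one from
  appending them.\<close>

lemma variation_add:
  assumes "rectifiable_path \<gamma>" "0 \<le> a" "a \<le> b" "b \<le> c" "c \<le> 1"
  shows "variation \<gamma> a c = variation \<gamma> a b + variation \<gamma> b c"
proof (rule antisym)
  have ac: "a \<le> c" using assms by linarith
  have ne: "chord_sums \<gamma> a b \<noteq> {}" "chord_sums \<gamma> b c \<noteq> {}" "chord_sums \<gamma> a c \<noteq> {}"
    using chord_in_chord_sums assms ac by blast+
  show "variation \<gamma> a c \<le> variation \<gamma> a b + variation \<gamma> b c"
    unfolding variation_def[of _ a c]
  proof (rule cSup_least[OF ne(3)])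
    fix x assume "x \<in> chord_sums \<gamma> a c"
    then obtain m t where x: "x = (\<Sum>i<m. norm (\<gamma> (t (Suc i)) - \<gamma> (t i)))"
      and t: "t 0 = a" "t m = c" "\<And>i. i < m \<Longrightarrow> t i \<le> t (Suc i)"
      unfolding chord_sums_def by blast
    obtain y z where yz: "y \<in> chord_sums \<gamma> a b" "z \<in> chord_sums \<gamma> b c" "x \<le> y + z"
      unfolding x using truncated_chord_sums[of t a m c b \<gamma>] t assms(3,4) by blast
    have "y \<le> variation \<gamma> a b" "z \<le> variation \<gamma> b c"
      using yz assms by (auto intro!: chord_sum_le_variation)
    with yz(3) show "x \<le> variation \<gamma> a b + variation \<gamma> b c" by linarith
  qed
  have "x + y \<le> variation \<gamma> a c" if "x \<in> chord_sums \<gamma> a b" "y \<in> chord_sums \<gamma> b c" for x y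
    using assms ac chord_sums_append[OF that] by (intro chord_sum_le_variation) auto
  then have "x \<le> variation \<gamma> a c - y" if "x \<in> chord_sums \<gamma> a b" "y \<in> chord_sums \<gamma> b c" for x y
    using that by (simp add: le_diff_eq)
  then have "variation \<gamma> a b \<le> variation \<gamma> a c - y" if "y \<in> chord_sums \<gamma> b c" for y
    unfolding variation_def[of _ a b] using that by (intro cSup_least[OF ne(1)])
  then have "y \<le> variation \<gamma> a c - variation \<gamma> a b" if "y \<in> chord_sums \<gamma> b c" for y
    using that by (simp add: le_diff_eq add.commute)
  then have "variation \<gamma> b c \<le> variation \<gamma> a c - variation \<gamma> a b"
    unfolding variation_def[of _ b c] by (intro cSup_least[OF ne(2)])
  then show "variation \<gamma> a b + variation \<gamma> b c \<le> variation \<gamma> a c" by linarith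
qed

lemma arc_length_diff:
  assumes "rectifiable_path \<gamma>" "0 \<le> s" "s \<le> t" "t \<le> 1"
  shows "arc_length \<gamma> t - arc_length \<gamma> s = variation \<gamma> s t"
proof -
  have "max 0 (min 1 s) = s" "max 0 (min 1 t) = t" using assms by auto
  then show ?thesis
    using variation_add[of \<gamma> 0 s t] assms by (simp add: arc_length_eq_variation)
qed

lemma arc_length_nonpos: "t \<le> 0 \<Longrightarrow> arc_length \<gamma> t = 0"
  by (simp add: arc_length_def chord_sums_refl)

lemma mono_arc_length:
  assumes "rectifiable_path \<gamma>" "s \<le> t"
  shows "arc_length \<gamma> s \<le> arc_length \<gamma> t"
proof -
  define s' t' where "s' = max 0 (min 1 s)" and "t' = max 0 (min 1 t)"
  have "arc_length \<gamma> t' - arc_length \<gamma> s' = variation \<gamma> s' t'"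
    using assms by (intro arc_length_diff) (auto simp: s'_def t'_def)
  moreover have "variation \<gamma> s' t' \<ge> norm (\<gamma> t' - \<gamma> s')"
    using assms by (intro norm_diff_le_variation) (auto simp: s'_def t'_def)
  moreover have "arc_length \<gamma> s = arc_length \<gamma> s'" "arc_length \<gamma> t = arc_length \<gamma> t'"
    by (auto simp: arc_length_def s'_def t'_def)
  ultimately show ?thesis
    using norm_ge_zero[of "\<gamma> t' - \<gamma> s'"] by linarith
qed

text \<open>A chord sum over \<open>[s, 1]\<close> that almost exhausts the variation, truncated at \<open>u\<close>, leaves over
  \<open>[s, u]\<close> a finite sum of chords whose endpoints all tend to \<open>\<gamma> s\<close> as \<open>u\<close> decreases to \<open>s\<close>.
  Hence the variation over \<open>[u, 1]\<close> almost exhausts that over \<open>[s, 1]\<close>.\<close>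

lemma variation_tendsto_0:
  assumes rect: "rectifiable_path \<gamma>" and s: "0 \<le> s" "s < 1" and e: "e > 0"
  shows "\<exists>d>0. \<forall>u. s \<le> u \<and> u \<le> 1 \<and> u < s + d \<longrightarrow> variation \<gamma> s u < e"
proof -
  have ne: "chord_sums \<gamma> s 1 \<noteq> {}"
    using chord_in_chord_sums[of s 1 \<gamma>] s by auto
  obtain x where x: "x \<in> chord_sums \<gamma> s 1" "variation \<gamma> s 1 - e / 2 < x"
    using less_cSupD[OF ne, of "variation \<gamma> s 1 - e / 2"] e by (auto simp: variation_def)
  obtain m t where x_eq: "x = (\<Sum>i<m. norm (\<gamma> (t (Suc i)) - \<gamma> (t i)))"
    and t: "t 0 = s" "t m = 1" "\<And>i. i < m \<Longrightarrow> t i \<le> t (Suc i)"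
    using x(1) unfolding chord_sums_def by blast
  note trunc = truncated_chord_sums[of t s m 1 _ \<gamma>, OF t]
  define S where "S u = (\<Sum>i<m. norm (\<gamma> (min (t (Suc i)) u) - \<gamma> (min (t i) u)))" for u
  have cont: "continuous_on {0..1} \<gamma>"
    using rect by (simp add: rectifiable_path_def path_def)
  have t_range: "s \<le> t i" "t i \<le> 1" if "i \<le> m" for i
    using partition_bounds[of m t i] t that by auto
  have "continuous_on {s..1} (\<lambda>u. \<gamma> (min (t i) u))" if "i \<le> m" for i
    by (rule continuous_on_compose2[OF cont]) (use t_range[OF that] s in \<open>auto intro!: continuous_intros\<close>)
  then have "continuous_on {s..1} S"
    unfolding S_def by (intro continuous_intros) auto
  moreover have "S s = 0"
    unfolding S_def using t_range by (auto intro!: sum.neutral simp: min_absorb2)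
  ultimately obtain d where d: "d > 0" "\<And>u. u \<in> {s..1} \<Longrightarrow> dist u s < d \<Longrightarrow> dist (S u) 0 < e / 2"
    using s e unfolding continuous_on_iff by (metis atLeastAtMost_iff half_gt_zero less_eq_real_def)
  show ?thesis
  proof (intro exI[of _ d] conjI allI impI d(1))
    fix u assume u: "s \<le> u \<and> u \<le> 1 \<and> u < s + d"
    have "S u < e / 2"
      using d(2)[of u] u by (auto simp: dist_real_def)
    moreover have "(\<Sum>i<m. norm (\<gamma> (max (t (Suc i)) u) - \<gamma> (max (t i) u))) \<le> variation \<gamma> u 1"
      using u s by (intro chord_sum_le_variation rect trunc(2)) auto
    ultimately have "variation \<gamma> s 1 - variation \<gamma> u 1 < e"
      using trunc(3)[of u] u x(2) unfolding S_def x_eq by linarith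
    then show "variation \<gamma> s u < e"
      using variation_add[OF rect, of s u 1] u s by simp
  qed
qed

lemma continuous_at_right_arc_length:
  assumes rect: "rectifiable_path \<gamma>"
  shows "continuous (at_right s) (arc_length \<gamma>)"
proof -
  have "\<exists>d>0. \<forall>u. s < u \<and> u < s + d \<longrightarrow> arc_length \<gamma> u - arc_length \<gamma> s < e" if e: "e > 0" for e
  proof -
    consider "s < 0" | "0 \<le> s" "s < 1" | "1 \<le> s" by linarith
    then show ?thesis
    proof cases
      case 1
      then show ?thesis
        using e by (intro exI[of _ "-s"]) (auto simp: arc_length_nonpos)
    next
      case 2
      obtain d where d: "d > 0" "\<And>u. s \<le> u \<Longrightarrow> u \<le> 1 \<Longrightarrow> u < s + d \<Longrightarrow> variation \<gamma> s u < e"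
        using variation_tendsto_0[OF rect 2 e] by blast
      show ?thesis
        using d 2 by (intro exI[of _ "min d (1 - s)"]) (auto simp: arc_length_diff[OF rect])
    next
      case 3
      then have "arc_length \<gamma> u = arc_length \<gamma> s" if "s < u" for u
        using that by (simp add: arc_length_def)
      then show ?thesis
        using e by (intro exI[of _ 1]) auto
    qed
  qed
  note close = this
  show ?thesis
    unfolding continuous_within tendsto_iff
  proof (intro allI impI)
    fix e :: real assume "e > 0"
    from close[OF this] obtain d where d: "d > 0"
      "\<And>u. s < u \<Longrightarrow> u < s + d \<Longrightarrow> arc_length \<gamma> u - arc_length \<gamma> s < e"
      by blast
    show "\<forall>\<^sub>F u in at_right s. dist (arc_length \<gamma> u) (arc_length \<gamma> s) < e"
      unfolding eventually_at_right_field
    proof (intro exI[of _ "s + d"] conjI allI impI)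
      fix u assume "s < u" "u < s + d"
      then show "dist (arc_length \<gamma> u) (arc_length \<gamma> s) < e"
        using d(2)[of u] mono_arc_length[OF rect, of s u] by (simp add: dist_real_def)
    qed (use d in simp)
  qed
qed

section \<open>Integrals with respect to arc length\<close>

abbreviation arc_measure :: "(real \<Rightarrow> 'a::real_normed_vector) \<Rightarrow> real measure" where
  "arc_measure \<gamma> \<equiv> interval_measure (arc_length \<gamma>)"

lemma emeasure_arc_Ioc:
  assumes "rectifiable_path \<gamma>" "a \<le> b"
  shows "emeasure (arc_measure \<gamma>) {a<..b} = ennreal (arc_length \<gamma> b - arc_length \<gamma> a)"
  using assms emeasure_interval_measure_Ioc[of a b "arc_length \<gamma>"]
    mono_arc_length continuous_at_right_arc_length by blast

lemma measure_arc_Ioc: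
  assumes "rectifiable_path \<gamma>" "a \<le> b"
  shows "measure (arc_measure \<gamma>) {a<..b} = arc_length \<gamma> b - arc_length \<gamma> a"
  using emeasure_arc_Ioc[OF assms] mono_arc_length[OF assms] by (simp add: measure_def)

lemma emeasure_arc_subset_finite:
  assumes "rectifiable_path \<gamma>" "A \<subseteq> {0..1}"
  shows "emeasure (arc_measure \<gamma>) A \<noteq> \<infinity>"
proof -
  have "emeasure (arc_measure \<gamma>) A \<le> emeasure (arc_measure \<gamma>) {-1<..1}"
    using assms(2) by (intro emeasure_mono) auto
  also have "\<dots> < \<infinity>" using emeasure_arc_Ioc[OF assms(1), of "-1" 1] by simp
  finally show ?thesis by simp
qed

text \<open>The point \<open>0\<close> carries no mass, since the arc length function is constantly \<open>0\<close> to the left of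
  it; the total mass of \<open>[0, 1]\<close> is therefore at most the length of the curve.\<close>

lemma measure_arc_Icc_le:
  assumes "rectifiable_path \<gamma>"
  shows "measure (arc_measure \<gamma>) {0..1} \<le> variation \<gamma> 0 1"
proof -
  have "measure (arc_measure \<gamma>) {0..1} \<le> measure (arc_measure \<gamma>) {-1<..1}"
    using emeasure_arc_Ioc[OF assms, of "-1" 1] by (intro measure_mono_fmeasurable) (auto simp: fmeasurable_def)
  also have "\<dots> = variation \<gamma> 0 1"
    by (simp add: measure_arc_Ioc[OF assms] arc_length_eq_variation variation_def chord_sums_refl)
  finally show ?thesis .
qed

lemma set_integrable_arc:
  fixes r :: "'a::real_normed_vector \<Rightarrow> real"
  assumes rect: "rectifiable_path \<gamma>" and cont: "continuous_on (path_image \<gamma>) r"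
  shows "set_integrable (arc_measure \<gamma>) {0..1} (\<lambda>t. r (\<gamma> t))"
proof -
  have c: "continuous_on {0..1} (\<lambda>t. r (\<gamma> t))"
    using rect cont by (auto simp: rectifiable_path_def path_def path_image_def
        intro: continuous_on_compose2)
  then have "bounded ((\<lambda>t. r (\<gamma> t)) ` {0..1})"
    by (intro compact_imp_bounded compact_continuous_image) auto
  then obtain B where B: "\<And>t. t \<in> {0..1} \<Longrightarrow> norm (r (\<gamma> t)) \<le> B"
    unfolding bounded_iff by blast
  have "set_integrable (arc_measure \<gamma>) {0..1} (\<lambda>_. B)"
    unfolding set_integrable_def using emeasure_arc_subset_finite[OF rect, of "{0..1}"]
    by (auto simp: top.not_eq_extremum)
  then show ?thesis
  proof (rule set_integrable_bound)
    show "set_borel_measurable (arc_measure \<gamma>) {0..1} (\<lambda>t. r (\<gamma> t))"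
      unfolding set_borel_measurable_def
      using borel_measurable_continuous_on_indicator[OF _ c] by simp
    show "AE t in arc_measure \<gamma>. t \<in> {0..1} \<longrightarrow> norm (r (\<gamma> t)) \<le> norm B"
      using B by (intro AE_I2) force
  qed
qed

lemma arc_integral_nonneg:
  assumes "\<And>z. z \<in> path_image \<gamma> \<Longrightarrow> 0 \<le> r z"
  shows "0 \<le> arc_integral \<gamma> r"
  unfolding arc_integral_def set_lebesgue_integral_def
  using assms by (intro integral_nonneg_AE AE_I2) (auto simp: indicator_def path_image_def)

lemma arc_integral_le_length:
  assumes rect: "rectifiable_path \<gamma>" and cont: "continuous_on (path_image \<gamma>) r"
    and bound: "\<And>z. z \<in> path_image \<gamma> \<Longrightarrow> r z \<le> B" and "0 \<le> B"
  shows "arc_integral \<gamma> r \<le> B * variation \<gamma> 0 1"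
proof -
  have "arc_integral \<gamma> r \<le> (LINT t:{0..1}|arc_measure \<gamma>. B)"
    unfolding arc_integral_def
    by (intro set_integral_mono set_integrable_arc[OF rect] cont set_integrable_arc[OF rect, of "\<lambda>_. B"])
       (use bound in \<open>auto simp: path_image_def\<close>)
  also have "\<dots> = measure (arc_measure \<gamma>) {0..1} * B"
    using emeasure_arc_subset_finite[OF rect, of "{0..1}"] by (subst set_integral_const) auto
  also have "\<dots> \<le> variation \<gamma> 0 1 * B"
    using measure_arc_Icc_le[OF rect] \<open>0 \<le> B\<close> by (rule mult_right_mono)
  finally show ?thesis by (simp add: mult.commute)
qed

section \<open>Integrating a local Lipschitz constant along a curve\<close>

text \<open>If \<open>r\<close> is a local Lipschitz constant of \<open>f\<close> up to an arbitrarily small error, then it is an upper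
  gradient of \<open>f\<close>. On a short piece of the curve \<open>f\<close> changes by at most \<open>r + \<epsilon>\<close> at one point
  times the chord, hence by at most the integral of \<open>r + 2\<epsilon>\<close> over the piece, because \<open>r\<close> varies
  by less than \<open>\<epsilon>\<close> there. Such estimates add up over adjacent pieces, so Bolzano's principle
  extends them to the whole curve.\<close>

lemma norm_diff_le_arc_integral:
  fixes f :: "'a::real_normed_vector \<Rightarrow> 'b::real_normed_vector" and r :: "'a \<Rightarrow> real"
  assumes rect: "rectifiable_path \<gamma>" and cont: "continuous_on (path_image \<gamma>) r"
    and nonneg: "\<And>z. z \<in> path_image \<gamma> \<Longrightarrow> 0 \<le> r z"
    and lip: "\<And>z e. z \<in> path_image \<gamma> \<Longrightarrow> e > 0 \<Longrightarrow>
      \<exists>d>0. \<forall>x\<in>ball z d. \<forall>y\<in>ball z d. norm (f x - f y) \<le> (r z + e) * norm (x - y)"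
  shows "norm (f (pathfinish \<gamma>) - f (pathstart \<gamma>)) \<le> arc_integral \<gamma> r"
proof -
  let ?M = "arc_measure \<gamma>" and ?L = "arc_length \<gamma>"
  have int: "set_integrable ?M {s<..t} (\<lambda>u. r (\<gamma> u))" if "0 \<le> s" "t \<le> 1" for s t
    by (rule set_integrable_subset[OF set_integrable_arc[OF rect cont]]) (use that in auto)
  have c\<gamma>: "continuous_on {0..1} \<gamma>"
    using rect by (simp add: rectifiable_path_def path_def)
  have cr: "continuous_on {0..1} (\<lambda>t. r (\<gamma> t))"
    using c\<gamma> cont by (auto simp: path_image_def intro: continuous_on_compose2)
  have approx: "norm (f (\<gamma> 1) - f (\<gamma> 0)) \<le> arc_integral \<gamma> r + 2 * e * ?L 1" if e: "e > 0" for e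
  proof -
    define P where "P s t \<longleftrightarrow> (0 \<le> s \<and> s \<le> t \<and> t \<le> 1 \<longrightarrow>
      norm (f (\<gamma> t) - f (\<gamma> s)) \<le> (LINT u:{s<..t}|?M. r (\<gamma> u)) + 2 * e * (?L t - ?L s))" for s t
    have "P 0 1"
    proof (rule Bolzano)
      fix s t u assume *: "P s t" "P t u" "s \<le> t" "t \<le> u"
      show "P s u"
        unfolding P_def
      proof
        assume su: "0 \<le> s \<and> s \<le> u \<and> u \<le> 1"
        have "{s<..u} = {s<..t} \<union> {t<..u}" "{s<..t} \<inter> {t<..u} = {}" using * by auto
        then have "(LINT v:{s<..u}|?M. r (\<gamma> v)) =
            (LINT v:{s<..t}|?M. r (\<gamma> v)) + (LINT v:{t<..u}|?M. r (\<gamma> v))"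
          using su * by (simp add: set_integral_Un int)
        moreover have "norm (f (\<gamma> u) - f (\<gamma> s)) \<le> norm (f (\<gamma> t) - f (\<gamma> s)) + norm (f (\<gamma> u) - f (\<gamma> t))"
          by (metis add.commute diff_add_cancel add_diff_eq norm_triangle_ineq)
        ultimately show "norm (f (\<gamma> u) - f (\<gamma> s)) \<le>
            (LINT v:{s<..u}|?M. r (\<gamma> v)) + 2 * e * (?L u - ?L s)"
          using * su unfolding P_def by (simp add: algebra_simps)
      qed
    next
      fix x :: real assume x: "0 \<le> x" "x \<le> 1"
      then have "\<gamma> x \<in> path_image \<gamma>" by (auto simp: path_image_def)
      from lip[OF this e] obtain d where d: "d > 0"
        "\<And>y z. y \<in> ball (\<gamma> x) d \<Longrightarrow> z \<in> ball (\<gamma> x) d \<Longrightarrow> norm (f y - f z) \<le> (r (\<gamma> x) + e) * norm (y - z)"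
        by blast
      obtain d1 where d1: "d1 > 0" "\<And>u. u \<in> {0..1} \<Longrightarrow> dist u x < d1 \<Longrightarrow> dist (\<gamma> u) (\<gamma> x) < d"
        using c\<gamma> x d(1) unfolding continuous_on_iff by (metis atLeastAtMost_iff)
      obtain d2 where d2: "d2 > 0" "\<And>u. u \<in> {0..1} \<Longrightarrow> dist u x < d2 \<Longrightarrow> dist (r (\<gamma> u)) (r (\<gamma> x)) < e"
        using cr x e unfolding continuous_on_iff by (metis atLeastAtMost_iff)
      show "\<exists>d>0. \<forall>a b. a \<le> x \<and> x \<le> b \<and> b - a < d \<longrightarrow> P a b"
      proof (intro exI[of _ "min d1 d2"] conjI allI impI)
        fix a b assume ab: "a \<le> x \<and> x \<le> b \<and> b - a < min d1 d2"
        show "P a b"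
          unfolding P_def
        proof
          assume ab01: "0 \<le> a \<and> a \<le> b \<and> b \<le> 1"
          have near: "u \<in> {0..1}" "dist u x < d1" "dist u x < d2" if "a \<le> u" "u \<le> b" for u
            using that ab ab01 by (auto simp: dist_real_def)
          have "\<gamma> a \<in> ball (\<gamma> x) d" "\<gamma> b \<in> ball (\<gamma> x) d"
            using near d1 ab by (auto simp: dist_commute)
          then have "norm (f (\<gamma> b) - f (\<gamma> a)) \<le> (r (\<gamma> x) + e) * norm (\<gamma> b - \<gamma> a)"
            using d(2) by blast
          also have "\<dots> \<le> (r (\<gamma> x) + e) * (?L b - ?L a)"
            using norm_diff_le_variation[OF rect, of a b] arc_length_diff[OF rect, of a b] ab01 e
              nonneg[OF \<open>\<gamma> x \<in> path_image \<gamma>\<close>]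
            by (intro mult_left_mono) auto
          also have "\<dots> = (LINT u:{a<..b}|?M. r (\<gamma> x) - e) + 2 * e * (?L b - ?L a)"
          proof -
            have "{a<..b} \<subseteq> {0..1}" using ab01 by auto
            then show ?thesis
              using emeasure_arc_subset_finite[OF rect, of "{a<..b}"] ab01
              by (subst set_integral_const) (auto simp: measure_arc_Ioc[OF rect] algebra_simps)
          qed
          also have "(LINT u:{a<..b}|?M. r (\<gamma> x) - e) \<le> (LINT u:{a<..b}|?M. r (\<gamma> u))"
          proof (rule set_integral_mono)
            show "set_integrable ?M {a<..b} (\<lambda>u. r (\<gamma> x) - e)"
              by (rule set_integrable_subset[OF set_integrable_arc[OF rect, of "\<lambda>_. r (\<gamma> x) - e"]])
                 (use ab01 in auto)
            show "r (\<gamma> x) - e \<le> r (\<gamma> u)" if "u \<in> {a<..b}" for u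
              using d2(2)[of u] near[of u] that by (auto simp: dist_real_def)
          qed (use int ab01 in auto)
          finally show "norm (f (\<gamma> b) - f (\<gamma> a)) \<le> (LINT u:{a<..b}|?M. r (\<gamma> u)) + 2 * e * (?L b - ?L a)"
            by simp
        qed
      qed (use d1 d2 in auto)
    qed auto
    then have "norm (f (\<gamma> 1) - f (\<gamma> 0)) \<le> (LINT u:{0<..1}|?M. r (\<gamma> u)) + 2 * e * ?L 1"
      by (simp add: P_def arc_length_nonpos)
    also have "(LINT u:{0<..1}|?M. r (\<gamma> u)) \<le> arc_integral \<gamma> r"
      unfolding arc_integral_def set_lebesgue_integral_def
      using int[of 0 1] set_integrable_arc[OF rect cont] nonneg
      by (intro integral_mono) (auto simp: set_integrable_def path_image_def indicator_def)
    finally show ?thesis by simp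
  qed
  have L: "0 \<le> ?L 1"
    using mono_arc_length[OF rect, of 0 1] by (simp add: arc_length_nonpos)
  have "norm (f (\<gamma> 1) - f (\<gamma> 0)) \<le> arc_integral \<gamma> r + e" if "e > 0" for e
  proof -
    define e' where "e' = e / (2 * (?L 1 + 1))"
    have "e' > 0" using that L by (simp add: e'_def)
    moreover have "2 * e' * ?L 1 \<le> e"
      using that L by (simp add: e'_def field_simps)
    ultimately show ?thesis using approx[of e'] by linarith
  qed
  then show ?thesis
    unfolding pathfinish_def pathstart_def by (rule field_le_epsilon)
qed

section \<open>Rectifiability of Lipschitz paths\<close>

lemma lipschitz_path_rectifiable:
  fixes \<gamma> :: "real \<Rightarrow> 'a::real_normed_vector"
  assumes lip: "\<And>s t. 0 \<le> s \<Longrightarrow> s \<le> t \<Longrightarrow> t \<le> 1 \<Longrightarrow> norm (\<gamma> t - \<gamma> s) \<le> B * (t - s)"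
    and "path \<gamma>"
  shows "rectifiable_path \<gamma>" "variation \<gamma> 0 1 \<le> B"
proof -
  have le: "x \<le> B" if x: "x \<in> chord_sums \<gamma> 0 1" for x
  proof -
    obtain m t where x: "x = (\<Sum>i<m. norm (\<gamma> (t (Suc i)) - \<gamma> (t i)))"
      and t: "t 0 = 0" "t m = 1" "\<And>i. i < m \<Longrightarrow> t i \<le> t (Suc i)"
      using x unfolding chord_sums_def by blast
    have "0 \<le> t i" "t i \<le> 1" if "i \<le> m" for i
      using partition_bounds[of m t i] t that by auto
    then have "x \<le> (\<Sum>i<m. B * (t (Suc i) - t i))"
      unfolding x using t by (intro sum_mono lip) auto
    also have "\<dots> = B"
      using t by (simp add: sum_distrib_left[symmetric] sum_lessThan_telescope)
    finally show ?thesis .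
  qed
  show "rectifiable_path \<gamma>"
    using le assms(2) by (auto simp: rectifiable_path_def bdd_above_def)
  show "variation \<gamma> 0 1 \<le> B"
    unfolding variation_def using le chord_in_chord_sums[of 0 1 \<gamma>] by (intro cSup_least) auto
qed

lemma rectifiable_linepath: "rectifiable_path (linepath a b)"
  and variation_linepath_le: "variation (linepath a b) 0 1 \<le> norm (b - a)"
proof -
  have eq: "norm (linepath a b t - linepath a b s) \<le> norm (b - a) * (t - s)" if "s \<le> t" for s t
  proof -
    have "linepath a b t - linepath a b s = (t - s) *\<^sub>R (b - a)"
      by (simp add: linepath_def algebra_simps)
    then show ?thesis using that by simp
  qed
  show "rectifiable_path (linepath a b)" "variation (linepath a b) 0 1 \<le> norm (b - a)"
    using lipschitz_path_rectifiable[of "linepath a b" "norm (b - a)"] eq by auto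
qed

text \<open>Points of a domain can be joined by polynomial paths, so this shows that the infimum defining the
  weighted metric is over a nonempty set.\<close>

lemma rectifiable_polynomial_path:
  fixes p :: "real \<Rightarrow> 'a::euclidean_space"
  assumes "polynomial_function p"
  shows "rectifiable_path p"
proof -
  obtain p' where p': "polynomial_function p'" "\<And>x. (p has_vector_derivative p' x) (at x)"
    using has_vector_derivative_polynomial_function[OF assms] by blast
  have "bounded (p' ` {0..1})"
    by (intro compact_imp_bounded compact_continuous_image continuous_on_polymonial_function p'(1)) auto
  then obtain B where B: "\<And>x. x \<in> {0..1} \<Longrightarrow> norm (p' x) \<le> B"
    unfolding bounded_iff by blast
  have "norm (p t - p s) \<le> B * norm (t - s)" if "0 \<le> s" "s \<le> t" "t \<le> 1" for s t
  proof (rule differentiable_bound[of "{0..1}" p "\<lambda>x h. h *\<^sub>R p' x"])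
    show "(p has_derivative (\<lambda>h. h *\<^sub>R p' x)) (at x within {0..1})" for x
      using p'(2)[of x] has_derivative_at_withinI unfolding has_vector_derivative_def by blast
    show "onorm (\<lambda>h. h *\<^sub>R p' x) \<le> B" if "x \<in> {0..1}" for x
      using mult_left_mono[OF B[OF that] abs_ge_zero] by (intro onorm_le) (simp add: mult.commute)
  qed (use that in auto)
  moreover have "path p"
    using assms by (simp add: path_def continuous_on_polymonial_function)
  ultimately show ?thesis
    by (intro lipschitz_path_rectifiable(1)[of p B]) auto
qed

section \<open>The weighted metric\<close>

lemma majorant_mono: "majorant \<omega> \<Longrightarrow> 0 \<le> s \<Longrightarrow> s \<le> t \<Longrightarrow> \<omega> s \<le> \<omega> t"
  unfolding majorant_def monotone_on_def by simp

lemma majorant_ratio_antimono: "majorant \<omega> \<Longrightarrow> 0 < s \<Longrightarrow> s \<le> t \<Longrightarrow> \<omega> t / t \<le> \<omega> s / s"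
  unfolding majorant_def monotone_on_def by simp

lemma majorant_nonneg: "majorant \<omega> \<Longrightarrow> 0 \<le> t \<Longrightarrow> 0 \<le> \<omega> t"
  unfolding majorant_def by simp

lemma frontier_proper_domain:
  fixes G :: "'a::euclidean_space set"
  assumes "is_domain G" "G \<noteq> UNIV"
  shows "frontier G \<noteq> {}"
  using assms by (simp add: is_domain_def frontier_eq_empty)

lemma bdist_pos:
  fixes G :: "'a::euclidean_space set"
  assumes "is_domain G" "G \<noteq> UNIV" "z \<in> G"
  shows "0 < bdist G z"
proof -
  have "z \<notin> frontier G"
    using assms by (auto simp: is_domain_def frontier_def interior_open)
  then show ?thesis
    unfolding bdist_def using infdist_pos_not_in_closed[OF frontier_closed frontier_proper_domain[OF assms(1,2)]]
    by simp
qed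

text \<open>A ball that meets both \<open>G\<close> and its complement is connected and so meets the boundary.\<close>

lemma ball_bdist_subset:
  fixes G :: "'a::euclidean_space set"
  assumes "z \<in> G"
  shows "ball z (bdist G z) \<subseteq> G"
proof (rule ccontr)
  assume *: "\<not> ball z (bdist G z) \<subseteq> G"
  then have "z \<in> ball z (bdist G z)"
    by (metis ball_eq_empty centre_in_ball empty_subsetI not_less)
  with * assms have "ball z (bdist G z) \<inter> frontier G \<noteq> {}"
    by (intro connected_Int_frontier connected_ball) blast+
  then obtain x where "x \<in> ball z (bdist G z)" "x \<in> frontier G"
    by blast
  then show False
    using infdist_le[of x "frontier G" z] by (simp add: bdist_def)
qed

lemma continuous_on_bdist: "continuous_on S (bdist G)"
  unfolding bdist_def by (intro continuous_intros)

lemma continuous_on_weight: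
  fixes G :: "'a::euclidean_space set"
  assumes "is_domain G" "G \<noteq> UNIV" "majorant \<omega>"
  shows "continuous_on G (\<lambda>z. \<omega> (bdist G z) / bdist G z)"
proof (rule continuous_on_divide)
  have "continuous_on {0..} \<omega>"
    using assms(3) by (simp add: majorant_def)
  then show "continuous_on G (\<lambda>z. \<omega> (bdist G z))"
    by (rule continuous_on_compose2[OF _ continuous_on_bdist]) (auto simp: bdist_def infdist_nonneg)
  show "continuous_on G (bdist G)"
    by (rule continuous_on_bdist)
  show "\<forall>z\<in>G. bdist G z \<noteq> 0"
    using bdist_pos[OF assms(1,2)] by (metis less_irrefl)
qed

lemma weight_nonneg:
  assumes "majorant \<omega>"
  shows "0 \<le> \<omega> (bdist G z) / bdist G z"
  using assms by (auto simp: majorant_def bdist_def infdist_nonneg)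

text \<open>The segment itself competes in the infimum, and the infimum is over numbers bounded below by
  \<open>0\<close>.\<close>

lemma d_om_le_segment:
  fixes G :: "'a::euclidean_space set"
  assumes "is_domain G" "G \<noteq> UNIV" "majorant \<omega>"
    and sub: "closed_segment z w \<subseteq> G"
    and bound: "\<And>u. u \<in> closed_segment z w \<Longrightarrow> \<omega> (bdist G u) / bdist G u \<le> B"
  shows "d_om \<omega> G z w \<le> B * norm (w - z)"
proof -
  let ?r = "\<lambda>z. \<omega> (bdist G z) / bdist G z"
  have "0 \<le> B" using bound[of z] weight_nonneg[OF assms(3), of G z] by simp
  have "d_om \<omega> G z w \<le> arc_integral (linepath z w) ?r"
    unfolding d_om_def
  proof (rule cInf_lower)
    show "bdd_below {arc_integral \<gamma> ?r |\<gamma>. rectifiable_path \<gamma> \<and> path_image \<gamma> \<subseteq> G \<and>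
        pathstart \<gamma> = z \<and> pathfinish \<gamma> = w}"
      by (rule bdd_belowI[of _ 0]) (auto intro!: arc_integral_nonneg weight_nonneg assms)
  qed (use rectifiable_linepath sub in fastforce)
  also have "\<dots> \<le> B * variation (linepath z w) 0 1"
  proof (rule arc_integral_le_length[OF rectifiable_linepath])
    show "continuous_on (path_image (linepath z w)) ?r"
      using continuous_on_subset[OF continuous_on_weight[OF assms(1-3)]] sub by simp
  qed (use bound \<open>0 \<le> B\<close> in simp_all)
  also have "\<dots> \<le> B * norm (w - z)"
    by (intro mult_left_mono variation_linepath_le \<open>0 \<le> B\<close>)
  finally show ?thesis .
qed

lemma le_d_om:
  fixes G :: "'a::euclidean_space set"
  assumes "is_domain G" "z \<in> G" "w \<in> G"
    and "\<And>\<gamma>. rectifiable_path \<gamma> \<Longrightarrow> path_image \<gamma> \<subseteq> G \<Longrightarrow> pathstart \<gamma> = z \<Longrightarrow> pathfinish \<gamma> = w \<Longrightarrow>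
      x \<le> arc_integral \<gamma> (\<lambda>z. \<omega> (bdist G z) / bdist G z)"
  shows "x \<le> d_om \<omega> G z w"
proof -
  let ?A = "{arc_integral \<gamma> (\<lambda>z. \<omega> (bdist G z) / bdist G z) |\<gamma>.
    rectifiable_path \<gamma> \<and> path_image \<gamma> \<subseteq> G \<and> pathstart \<gamma> = z \<and> pathfinish \<gamma> = w}"
  have "open G" "connected G" using assms(1) by (simp_all add: is_domain_def)
  then obtain p where "polynomial_function p" "path_image p \<subseteq> G" "pathstart p = z" "pathfinish p = w"
    using connected_open_polynomial_connected[of G z w] assms(2,3) by blast
  then have "?A \<noteq> {}"
    using rectifiable_polynomial_path by blast
  then show ?thesis
    unfolding d_om_def
  proof (rule cInf_greatest)
    show "x \<le> y" if "y \<in> ?A" for y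
      using that assms(4) by blast
  qed
qed

text \<open>By the mean value inequality and continuity of the weight, \<open>K\<close> times the weight is a local
  Lipschitz constant up to small errors, so it can be integrated along every competing curve.\<close>

lemma norm_diff_le_d_om_of_derivative:
  fixes G :: "'a::euclidean_space set" and f :: "'a \<Rightarrow> 'b::real_normed_vector"
  assumes dom: "is_domain G" "G \<noteq> UNIV" and om: "majorant \<omega>" and K: "0 < K"
    and der: "\<And>z. z \<in> G \<Longrightarrow> (f has_derivative f' z) (at z)"
    and bound: "\<And>z v. z \<in> G \<Longrightarrow> norm (f' z v) \<le> K * (\<omega> (bdist G z) / bdist G z) * norm v"
    and z: "z\<^sub>1 \<in> G" "z\<^sub>2 \<in> G"
  shows "norm (f z\<^sub>1 - f z\<^sub>2) \<le> K * d_om \<omega> G z\<^sub>1 z\<^sub>2"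
proof -
  define r where "r z = \<omega> (bdist G z) / bdist G z" for z
  have cont: "continuous_on G r"
    unfolding r_def by (rule continuous_on_weight[OF dom om])
  have lip: "\<exists>d>0. \<forall>x\<in>ball z d. \<forall>y\<in>ball z d. norm (f x - f y) \<le> (K * r z + e) * norm (x - y)"
    if z: "z \<in> G" and e: "e > 0" for z e
  proof -
    have "open G" using dom by (simp add: is_domain_def)
    then obtain d1 where d1: "d1 > 0" "ball z d1 \<subseteq> G"
      using z open_contains_ball by blast
    have "e / K > 0" using e K by simp
    then obtain d2 where d2: "d2 > 0" "\<And>x. x \<in> G \<Longrightarrow> dist x z < d2 \<Longrightarrow> dist (r x) (r z) < e / K"
      using cont z unfolding continuous_on_iff by blast
    define d where "d = min d1 d2"
    have onorm: "onorm (f' x) \<le> K * r z + e" if "x \<in> ball z d" for x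
    proof -
      have x: "x \<in> G" "dist x z < d2"
        using that d1(2) by (auto simp: d_def dist_commute)
      then have "r x \<le> r z + e / K"
        using d2(2)[of x] by (simp add: dist_real_def)
      then have "K * r x \<le> K * (r z + e / K)"
        using K by simp
      also have "\<dots> = K * r z + e"
        using K by (simp add: field_simps)
      finally have "K * r x * norm v \<le> (K * r z + e) * norm v" for v :: 'a
        by (rule mult_right_mono) simp
      then show ?thesis
        using bound[OF x(1)] unfolding r_def[symmetric] by (intro onorm_le) (rule order_trans)
    qed
    have "norm (f x - f y) \<le> (K * r z + e) * norm (x - y)" if "x \<in> ball z d" "y \<in> ball z d" for x y
    proof (rule differentiable_bound[OF convex_ball _ onorm])
      fix u assume "u \<in> ball z d"
      then have "u \<in> G" using d1(2) by (auto simp: d_def)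
      then show "(f has_derivative f' u) (at u within ball z d)"
        by (rule has_derivative_at_withinI[OF der])
    qed (use that in auto)
    moreover have "d > 0" using d1 d2 by (simp add: d_def)
    ultimately show ?thesis by blast
  qed
  have "norm (f z\<^sub>1 - f z\<^sub>2) / K \<le> d_om \<omega> G z\<^sub>1 z\<^sub>2"
  proof (rule le_d_om[OF dom(1) z], fold r_def)
    fix \<gamma> assume \<gamma>: "rectifiable_path \<gamma>" "path_image \<gamma> \<subseteq> G" "pathstart \<gamma> = z\<^sub>1" "pathfinish \<gamma> = z\<^sub>2"
    have "norm (f (pathfinish \<gamma>) - f (pathstart \<gamma>)) \<le> arc_integral \<gamma> (\<lambda>z. K * r z)"
    proof (rule norm_diff_le_arc_integral[OF \<gamma>(1)])
      show "continuous_on (path_image \<gamma>) (\<lambda>z. K * r z)"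
        by (intro continuous_intros continuous_on_subset[OF cont \<gamma>(2)])
      show "0 \<le> K * r z" for z
        unfolding r_def by (rule mult_nonneg_nonneg[OF less_imp_le[OF K] weight_nonneg[OF om]])
    qed (use lip \<gamma>(2) in blast)
    also have "\<dots> = K * arc_integral \<gamma> r"
      by (simp add: arc_integral_def)
    finally show "norm (f z\<^sub>1 - f z\<^sub>2) / K \<le> arc_integral \<gamma> r"
      using K \<gamma>(3,4) by (simp add: pos_divide_le_eq norm_minus_commute mult.commute)
  qed
  then show ?thesis using K by (simp add: pos_divide_le_eq mult.commute)
qed

text \<open>On the segment from \<open>z\<close> to \<open>w\<close> the distance to the boundary stays at least half of that at
  \<open>z\<close>. As \<open>\<omega> t / t\<close> is non-increasing, the weight there is at most \<open>\<omega> (d / 2) / (d / 2)\<close>, and the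
  segment is no longer than \<open>d / 2\<close>.\<close>

lemma abs_increment_half_ball:
  fixes G :: "'a::euclidean_space set" and u :: "'a \<Rightarrow> complex"
  assumes dom: "is_domain G" "G \<noteq> UNIV" and om: "majorant \<omega>"
    and C: "0 < C" "\<And>z w. z \<in> G \<Longrightarrow> w \<in> G \<Longrightarrow> cmod (u z - u w) \<le> C * d_om \<omega> G z w"
    and z: "z \<in> G" and w: "w \<in> ball z (bdist G z / 2)"
  shows "cmod (u z - u w) \<le> C * \<omega> (bdist G z)"
proof -
  let ?d = "bdist G z"
  have d: "?d > 0" using bdist_pos[OF dom z] .
  have seg: "closed_segment z w \<subseteq> ball z (?d / 2)"
    using w d by (intro closed_segment_subset) auto
  have sub: "ball z (?d / 2) \<subseteq> G"
    using ball_bdist_subset[OF z] d by (force simp: subset_iff)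
  have weight: "\<omega> (bdist G u) / bdist G u \<le> \<omega> (?d / 2) / (?d / 2)" if "u \<in> closed_segment z w" for u
  proof -
    have "?d \<le> bdist G u + dist z u"
      unfolding bdist_def by (rule infdist_triangle)
    then have "?d / 2 \<le> bdist G u" using that seg by (auto simp: subset_iff)
    then show ?thesis
      by (rule majorant_ratio_antimono[OF om, rotated]) (use d in simp)
  qed
  have om': "0 \<le> \<omega> (?d / 2)" "\<omega> (?d / 2) \<le> \<omega> ?d"
    using d by (auto intro: majorant_nonneg[OF om] majorant_mono[OF om])
  have "d_om \<omega> G z w \<le> \<omega> (?d / 2) / (?d / 2) * norm (w - z)"
    using order_trans[OF seg sub] by (intro d_om_le_segment dom om weight)
  also have "\<dots> \<le> \<omega> (?d / 2) / (?d / 2) * (?d / 2)"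
  proof (rule mult_left_mono)
    show "norm (w - z) \<le> ?d / 2" using w by (simp add: dist_norm norm_minus_commute)
  qed (use d om' in simp)
  also have "\<dots> = \<omega> (?d / 2)" using d by simp
  also note om'(2)
  finally have "C * d_om \<omega> G z w \<le> C * \<omega> ?d"
    using C(1) by simp
  moreover have "w \<in> G" using w sub by blast
  ultimately show ?thesis using C(2)[OF z, of w] by linarith
qed

section \<open>A derivative bound from the real part\<close>

text \<open>For \<open>N > M\<close> the Moebius transformation that maps the half-plane \<open>Re < N\<close> onto the unit disc and
  \<open>\<Phi> 0\<close> to \<open>0\<close> turns \<open>\<Phi>\<close> into a function \<open>\<phi>\<close> bounded by \<open>1\<close>. Cauchy's inequality bounds
  \<open>\<phi>'(0) = \<Phi>'(0) / (2 (N - Re (\<Phi> 0)))\<close>. Taking \<open>N\<close> strictly above \<open>M\<close> keeps the denominator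
  of the transformation away from \<open>0\<close> even when \<open>Re \<Phi>\<close> attains \<open>M\<close>.\<close>

lemma cmod_deriv_le_Re_bound:
  assumes hol: "\<Phi> holomorphic_on ball 0 R" and r: "0 < r" "r < R"
    and bound: "\<And>\<zeta>. cmod \<zeta> < R \<Longrightarrow> Re (\<Phi> \<zeta>) \<le> M"
  shows "cmod (deriv \<Phi> 0) \<le> 2 * (M - Re (\<Phi> 0)) / r"
proof -
  have strict: "cmod (deriv \<Phi> 0) \<le> 2 * (N - Re (\<Phi> 0)) / r" if N: "M < N" for N
  proof -
    define D where "D \<zeta> = 2 * complex_of_real N - \<Phi> \<zeta> - cnj (\<Phi> 0)" for \<zeta>
    \<comment> \<open>\<open>\<phi>\<close> is \<open>(P 0 - P) / (P + cnj (P 0))\<close> for \<open>P = N - \<Phi>\<close>, which has positive real part.\<close>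
    define \<phi> where "\<phi> \<zeta> = (\<Phi> \<zeta> - \<Phi> 0) / D \<zeta>" for \<zeta>
    have R: "0 < R" using r by simp
    have Re_lt: "Re (\<Phi> \<zeta>) < N" if "cmod \<zeta> < R" for \<zeta>
      using bound[OF that] N by simp
    have D0: "D \<zeta> \<noteq> 0" if "cmod \<zeta> < R" for \<zeta>
    proof -
      have "Re (D \<zeta>) > 0"
        using Re_lt[OF that] Re_lt[of 0] R by (simp add: D_def)
      then show ?thesis by force
    qed
    have hol_D: "D holomorphic_on ball 0 R"
      unfolding D_def by (intro holomorphic_intros hol)
    have hol_\<phi>: "\<phi> holomorphic_on ball 0 R"
      unfolding \<phi>_def using D0 by (intro holomorphic_intros hol hol_D) auto
    have "cmod (\<phi> \<zeta>) \<le> 1" if "cmod \<zeta> < R" for \<zeta>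
    proof -
      have "(cmod (D \<zeta>))\<^sup>2 - (cmod (\<Phi> \<zeta> - \<Phi> 0))\<^sup>2 = 4 * (N - Re (\<Phi> \<zeta>)) * (N - Re (\<Phi> 0))"
        unfolding cmod_power2 D_def by (simp add: power2_eq_square algebra_simps)
      also have "\<dots> \<ge> 0"
        using Re_lt[OF that] Re_lt[of 0] R by simp
      finally have "cmod (\<Phi> \<zeta> - \<Phi> 0) \<le> cmod (D \<zeta>)"
        using power2_le_imp_le[of "cmod (\<Phi> \<zeta> - \<Phi> 0)" "cmod (D \<zeta>)"] by simp
      then show ?thesis
        using D0[OF that] by (simp add: \<phi>_def norm_divide)
    qed
    then have "cmod ((deriv ^^ 1) \<phi> 0) \<le> fact 1 * 1 / r ^ 1"
      using r holomorphic_on_imp_continuous_on[OF hol_\<phi>]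
      by (intro Cauchy_inequality holomorphic_on_subset[OF hol_\<phi>])
         (auto intro: continuous_on_subset)
    then have 1: "cmod (deriv \<phi> 0) \<le> 1 / r" by simp
    have at0: "(F has_field_derivative deriv F 0) (at 0)" if "F holomorphic_on ball 0 R" for F
      using that R by (intro holomorphic_derivI) auto
    have "(\<phi> has_field_derivative (deriv \<Phi> 0 * D 0 - (\<Phi> 0 - \<Phi> 0) * deriv D 0) / (D 0 * D 0)) (at 0)"
      unfolding \<phi>_def
      by (rule DERIV_divide[where f = "\<lambda>\<zeta>. \<Phi> \<zeta> - \<Phi> 0" and g = D])
         (use at0[OF hol] at0[OF hol_D] D0[of 0] R in \<open>auto intro!: derivative_eq_intros\<close>)
    then have "deriv \<phi> 0 = deriv \<Phi> 0 / D 0"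
      using D0[of 0] R by (simp add: DERIV_imp_deriv)
    moreover have "D 0 = complex_of_real (2 * (N - Re (\<Phi> 0)))"
      by (simp add: D_def complex_eq_iff)
    then have "cmod (D 0) = 2 * (N - Re (\<Phi> 0))"
      using Re_lt[of 0] R by (simp only: norm_of_real) simp
    ultimately have "cmod (deriv \<Phi> 0) / (2 * (N - Re (\<Phi> 0))) \<le> 1 / r"
      using 1 by (simp only: norm_divide)
    then show ?thesis
      using Re_lt[of 0] R r by (simp add: field_simps)
  qed
  show ?thesis
  proof (rule field_le_epsilon)
    fix e :: real assume "e > 0"
    then have "cmod (deriv \<Phi> 0) \<le> 2 * (M + e * r / 2 - Re (\<Phi> 0)) / r"
      using r by (intro strict) simp
    also have "\<dots> = 2 * (M - Re (\<Phi> 0)) / r + e"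
      using r by (simp add: field_simps)
    finally show "cmod (deriv \<Phi> 0) \<le> 2 * (M - Re (\<Phi> 0)) / r + e" .
  qed
qed

section \<open>Wirtinger derivatives\<close>

definition lin_form :: "complex ^ 'n \<Rightarrow> complex ^ 'n \<Rightarrow> complex" where
  "lin_form a v = (\<Sum>j\<in>UNIV. a $ j * v $ j)"

lemma lin_form_smult: "lin_form a (c *s v) = c * lin_form a v"
  by (simp add: lin_form_def sum_distrib_left mult_ac)

lemma lin_form_scaleR: "lin_form a (t *\<^sub>R v) = t *\<^sub>R lin_form a v"
  by (simp add: lin_form_def scaleR_sum_right)

lemma lin_form_axis: "lin_form a (axis i c) = a $ i * c"
  by (simp add: lin_form_def axis_def if_distrib cong: if_cong)

lemma dir_deriv_eq:
  assumes "(f has_derivative f') (at z)"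
  shows "dir_deriv v f z = f' v"
proof -
  have "(f has_derivative f') (at (z + (0::real) *\<^sub>R v))" using assms by simp
  then have "((\<lambda>t::real. f (z + t *\<^sub>R v)) has_derivative (\<lambda>t. f' (t *\<^sub>R v))) (at 0)"
    by (rule has_derivative_compose[rotated]) (auto intro!: derivative_eq_intros)
  then have "((\<lambda>t::real. f (z + t *\<^sub>R v)) has_vector_derivative f' v) (at 0)"
    using linear_scale[OF has_derivative_linear[OF assms]] by (simp add: has_vector_derivative_def)
  then show ?thesis
    unfolding dir_deriv_def by (rule vector_derivative_at)
qed

text \<open>For \<open>f = h + cnj g\<close> the holomorphic part of the gradient is that of \<open>h\<close>, and the antiholomorphic
  part is the conjugate of the gradient of \<open>g\<close>.\<close>

lemma nabla_eq:
  assumes "(f has_derivative (\<lambda>v. lin_form a v + cnj (lin_form b v))) (at z)"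
  shows "nabla f z = a" "nabla_bar f z = vec_cnj b"
  by (auto simp: nabla_def nabla_bar_def vec_cnj_def vec_eq_iff dir_deriv_eq[OF assms] lin_form_axis
      algebra_simps)

lemma cdot_vec_cnj: "cdot a (vec_cnj v) = lin_form a v" "cdot (vec_cnj a) v = cnj (lin_form a v)"
  by (simp_all add: cdot_def vec_cnj_def lin_form_def)

lemma norm_smult_vec:
  fixes v :: "complex ^ 'n"
  shows "norm (c *s v) = cmod c * norm v"
  by (simp add: norm_vec_def norm_mult L2_set_right_distrib)

lemma slice_derivative:
  fixes h :: "complex ^ 'n \<Rightarrow> complex"
  assumes "(h has_derivative lin_form a) (at (z + \<zeta> *s \<theta>))"
  shows "((\<lambda>\<zeta>. h (z + \<zeta> *s \<theta>)) has_field_derivative lin_form a \<theta>) (at \<zeta>)"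
proof -
  have "linear (\<lambda>\<zeta>. \<zeta> *s \<theta>)"
    by (rule linearI) (simp_all add: vec_eq_iff algebra_simps)
  then have "bounded_linear (\<lambda>\<zeta>. \<zeta> *s \<theta>)"
    by (simp add: linear_conv_bounded_linear)
  then have "((\<lambda>\<zeta>. z + \<zeta> *s \<theta>) has_derivative (\<lambda>x. x *s \<theta>)) (at \<zeta>)"
    by (auto intro!: derivative_eq_intros bounded_linear_imp_has_derivative)
  from has_derivative_compose[OF this assms] show ?thesis
    by (simp add: has_field_derivative_def lin_form_smult mult_commute_abs)
qed

section \<open>Derivative bounds from bounds on the modulus\<close>

text \<open>Restricted to the complex line through \<open>z\<close> in the direction \<open>\<theta>\<close>, the real part of \<open>c f\<close> is the
  real part of the holomorphic function \<open>c h + cnj c g\<close>, for every constant \<open>c\<close>. Choosing \<open>c\<close> unimodular with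
  \<open>c f(z) = \<bar>f(z)\<bar>\<close> makes the excess of this real part over its central value at most
  \<open>M - \<bar>f(z)\<bar>\<close>. The hypothesis on \<open>b\<close> bounds the derivative of the holomorphic function from
  below by \<open>(1 - k)\<close> times that of \<open>h\<close>.\<close>

lemma derivative_le_of_abs_bound:
  fixes h g f :: "complex ^ 'n \<Rightarrow> complex"
  assumes hol: "holomorphic_vec_on h G" "holomorphic_vec_on g G"
    and f: "\<And>w. w \<in> G \<Longrightarrow> f w = h w + cnj (g w)"
    and R: "ball z R \<subseteq> G" "0 < r" "r < R" and M: "\<And>w. w \<in> ball z R \<Longrightarrow> cmod (f w) \<le> M"
    and ab: "(h has_derivative lin_form a) (at z)" "(g has_derivative lin_form b) (at z)"
    and \<theta>: "norm \<theta> = 1" and k: "k < 1" "cmod (lin_form b \<theta>) \<le> k * cmod (lin_form a \<theta>)"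
  shows "cmod (lin_form a \<theta>) \<le> 2 * (M - cmod (f z)) / ((1 - k) * r)"
proof -
  obtain c where c: "cmod c = 1" "c * f z = complex_of_real (cmod (f z))"
  proof (cases "f z = 0")
    case True
    then show ?thesis using that[of 1] by simp
  next
    case False
    then show ?thesis
    proof (intro that)
      show "cmod (cnj (f z) / cmod (f z)) = 1"
        using False by (simp add: norm_divide)
      show "cnj (f z) / cmod (f z) * f z = complex_of_real (cmod (f z))"
        using False complex_norm_square[of "f z"]
        by (simp add: divide_simps power2_eq_square mult.commute)
    qed
  qed
  define \<Phi> where "\<Phi> \<zeta> = c * h (z + \<zeta> *s \<theta>) + cnj c * g (z + \<zeta> *s \<theta>)" for \<zeta>
  have in_ball: "z + \<zeta> *s \<theta> \<in> ball z R" if "cmod \<zeta> < R" for \<zeta>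
    using that \<theta> by (simp add: dist_norm norm_smult_vec)
  have deriv: "(\<Phi> has_field_derivative c * lin_form a' \<theta> + cnj c * lin_form b' \<theta>) (at \<zeta>)"
    if "(h has_derivative lin_form a') (at (z + \<zeta> *s \<theta>))" "(g has_derivative lin_form b') (at (z + \<zeta> *s \<theta>))"
    for \<zeta> a' b'
    unfolding \<Phi>_def by (intro DERIV_add DERIV_cmult slice_derivative that)
  have "\<Phi> holomorphic_on ball 0 R"
    unfolding holomorphic_on_open[OF open_ball]
  proof
    fix \<zeta> :: complex assume "\<zeta> \<in> ball 0 R"
    then have "z + \<zeta> *s \<theta> \<in> G" using in_ball R by auto
    then obtain a' b' where "(h has_derivative lin_form a') (at (z + \<zeta> *s \<theta>))"
        "(g has_derivative lin_form b') (at (z + \<zeta> *s \<theta>))"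
      using hol unfolding holomorphic_vec_on_def lin_form_def[abs_def] by blast
    from deriv[OF this] show "\<exists>f'. (\<Phi> has_field_derivative f') (at \<zeta>)" by blast
  qed
  moreover have Re_\<Phi>: "Re (\<Phi> \<zeta>) = Re (c * f (z + \<zeta> *s \<theta>))" if "cmod \<zeta> < R" for \<zeta>
    using f[of "z + \<zeta> *s \<theta>"] in_ball[OF that] R(1) by (auto simp: \<Phi>_def algebra_simps)
  moreover have "Re (\<Phi> \<zeta>) \<le> M" if "cmod \<zeta> < R" for \<zeta>
    using Re_\<Phi>[OF that] M[OF in_ball[OF that]] complex_Re_le_cmod[of "c * f (z + \<zeta> *s \<theta>)"] c(1)
    by (simp add: norm_mult)
  ultimately have "cmod (deriv \<Phi> 0) \<le> 2 * (M - Re (\<Phi> 0)) / r"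
    using R by (intro cmod_deriv_le_Re_bound)
  moreover have "Re (\<Phi> 0) = cmod (f z)"
    using Re_\<Phi>[of 0] c(2) R by simp
  moreover have "deriv \<Phi> 0 = c * lin_form a \<theta> + cnj c * lin_form b \<theta>"
    using deriv[of a 0 b] ab by (simp add: DERIV_imp_deriv)
  moreover have "(1 - k) * cmod (lin_form a \<theta>) \<le> cmod (c * lin_form a \<theta> + cnj c * lin_form b \<theta>)"
    using norm_diff_ineq[of "c * lin_form a \<theta>" "cnj c * lin_form b \<theta>"] c(1) k(2)
    by (simp add: norm_mult algebra_simps)
  ultimately have "(1 - k) * cmod (lin_form a \<theta>) \<le> 2 * (M - cmod (f z)) / r" by simp
  then show ?thesis using k(1) R(2) by (simp add: field_simps)
qed

text \<open>The directional estimate is used with \<open>M = \<bar>f(z)\<bar> + C \<omega>(d)\<close>, on the ball of radius \<open>R = d / 2\<close>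
  where the increment of \<open>\<bar>f\<bar>\<close> is controlled, and with \<open>r = d / 4\<close>. This gives \<open>8 C / (1 - k)\<close>
  times the weight for \<open>h\<close>; that of \<open>g\<close> is no larger, hence the factor \<open>16\<close>.\<close>

lemma derivative_bound_of_abs_Lambda:
  fixes f :: "complex ^ 'n \<Rightarrow> complex"
  assumes dom: "is_domain G" "G \<noteq> UNIV" and om: "majorant \<omega>" and k: "k < 1"
    and f: "f \<in> H_class k G" and C: "0 < C"
    and osc: "\<And>z w. z \<in> G \<Longrightarrow> w \<in> G \<Longrightarrow>
      cmod (complex_of_real (cmod (f z)) - complex_of_real (cmod (f w))) \<le> C * d_om \<omega> G z w"
    and z: "z \<in> G"
  shows "\<exists>f'. (f has_derivative f') (at z) \<and>
    (\<forall>v. cmod (f' v) \<le> 16 * C / (1 - k) * (\<omega> (bdist G z) / bdist G z) * norm v)"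
proof -
  obtain h g where hol: "holomorphic_vec_on h G" "holomorphic_vec_on g G"
    and hg: "\<And>z. z \<in> G \<Longrightarrow> f z = h z + cnj (g z)"
    and qr: "\<And>\<theta>. norm \<theta> = 1 \<Longrightarrow>
      cmod (cdot (nabla_bar f z) \<theta>) \<le> k * cmod (cdot (nabla f z) (vec_cnj \<theta>))"
    using f z unfolding H_class_def by auto
  obtain a b where ab: "(h has_derivative lin_form a) (at z)" "(g has_derivative lin_form b) (at z)"
    using hol z unfolding holomorphic_vec_on_def lin_form_def[abs_def] by blast
  define d where "d = bdist G z"
  define B where "B = 8 * C / (1 - k) * (\<omega> d / d)"
  have d: "d > 0" unfolding d_def by (rule bdist_pos[OF dom z])
  have "((\<lambda>z. h z + cnj (g z)) has_derivative (\<lambda>v. lin_form a v + cnj (lin_form b v))) (at z)"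
    by (intro has_derivative_add has_derivative_cnj ab)
  then have der: "(f has_derivative (\<lambda>v. lin_form a v + cnj (lin_form b v))) (at z)"
    by (rule has_derivative_transform_within_open[of _ _ _ _ G])
       (use dom z hg in \<open>auto simp: is_domain_def\<close>)
  have b_le_a: "cmod (lin_form b \<theta>) \<le> k * cmod (lin_form a \<theta>)" if "norm \<theta> = 1" for \<theta>
    using qr[OF that] unfolding nabla_eq[OF der] cdot_vec_cnj by simp
  have sub: "ball z (d / 2) \<subseteq> G"
    using ball_bdist_subset[OF z] d by (force simp: d_def subset_iff)
  have M: "cmod (f w) \<le> cmod (f z) + C * \<omega> d" if "w \<in> ball z (d / 2)" for w
  proof -
    have "cmod (complex_of_real (cmod (f z)) - complex_of_real (cmod (f w))) \<le> C * \<omega> d"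
      using abs_increment_half_ball[OF dom om C, where u = "\<lambda>z. complex_of_real (cmod (f z))", OF osc z] that
      unfolding d_def by blast
    then have "\<bar>cmod (f z) - cmod (f w)\<bar> \<le> C * \<omega> d"
      by (simp only: of_real_diff[symmetric] norm_of_real)
    then show ?thesis by linarith
  qed
  have a_le: "cmod (lin_form a \<theta>) \<le> B" if \<theta>: "norm \<theta> = 1" for \<theta>
  proof -
    have "cmod (lin_form a \<theta>) \<le> 2 * (cmod (f z) + C * \<omega> d - cmod (f z)) / ((1 - k) * (d / 4))"
      by (rule derivative_le_of_abs_bound[OF hol hg sub _ _ M ab \<theta> k b_le_a[OF \<theta>]]) (use d in auto)
    also have "\<dots> = B"
      using d k by (simp add: B_def field_simps)
    finally show ?thesis .
  qed
  have unit: "cmod (lin_form a \<theta> + cnj (lin_form b \<theta>)) \<le> 2 * B" if \<theta>: "norm \<theta> = 1" for \<theta>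
  proof -
    have "cmod (lin_form b \<theta>) \<le> 1 * cmod (lin_form a \<theta>)"
      using b_le_a[OF \<theta>] mult_right_mono[of k 1 "cmod (lin_form a \<theta>)"] k by simp
    then show ?thesis
      using norm_triangle_ineq[of "lin_form a \<theta>" "cnj (lin_form b \<theta>)"] a_le[OF \<theta>] by simp
  qed
  have "cmod (lin_form a v + cnj (lin_form b v)) \<le> 2 * B * norm v" for v
  proof (cases "v = 0")
    case True
    then show ?thesis by (simp add: lin_form_def)
  next
    case False
    define \<theta> where "\<theta> = (1 / norm v) *\<^sub>R v"
    have v: "v = norm v *\<^sub>R \<theta>" and \<theta>: "norm \<theta> = 1"
      using False by (simp_all add: \<theta>_def)
    have "lin_form c v = norm v *\<^sub>R lin_form c \<theta>" for c
      using lin_form_scaleR[of c "norm v" \<theta>] unfolding v[symmetric] .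
    then have "lin_form a v + cnj (lin_form b v) = norm v *\<^sub>R (lin_form a \<theta> + cnj (lin_form b \<theta>))"
      by (simp add: scaleR_conv_of_real algebra_simps)
    then show ?thesis
      using mult_left_mono[OF unit[OF \<theta>] norm_ge_zero[of v]] by (simp add: mult.commute)
  qed
  moreover have "2 * B = 16 * C / (1 - k) * (\<omega> d / d)" by (simp add: B_def)
  ultimately show ?thesis using der unfolding d_def by auto
qed

theorem theorem3:
  fixes G :: "(complex ^ 'n) set" and \<omega> :: "real \<Rightarrow> real" and k :: real
    and f :: "complex ^ 'n \<Rightarrow> complex"
  assumes "is_domain G" and "G \<noteq> UNIV"
    and "majorant \<omega>"
    and "\<exists>\<delta>\<^sub>0>0. \<exists>C>0. \<forall>\<delta>. 0 < \<delta> \<and> \<delta> < \<delta>\<^sub>0 \<longrightarrow>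
           (\<lambda>t. \<omega> t / t) integrable_on {0..\<delta>} \<and> integral {0..\<delta>} (\<lambda>t. \<omega> t / t) \<le> C * \<omega> \<delta>"
    and "0 < k" and "k < 1"
    and "f \<in> H_class k G"
  shows "f \<in> Lambda_inf \<omega> G \<longleftrightarrow> (\<lambda>z. complex_of_real (cmod (f z))) \<in> Lambda_inf \<omega> G"
proof
  assume "f \<in> Lambda_inf \<omega> G"
  then obtain C where C: "C > 0" "\<And>z w. z \<in> G \<Longrightarrow> w \<in> G \<Longrightarrow> cmod (f z - f w) \<le> C * d_om \<omega> G z w"
    unfolding Lambda_inf_def by blast
  have "cmod (complex_of_real (cmod x) - complex_of_real (cmod y)) \<le> cmod (x - y)" for x y
    by (simp only: of_real_diff[symmetric] norm_of_real norm_triangle_ineq3)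
  from order_trans[OF this C(2)] C(1) show "(\<lambda>z. complex_of_real (cmod (f z))) \<in> Lambda_inf \<omega> G"
    unfolding Lambda_inf_def by blast
next
  assume "(\<lambda>z. complex_of_real (cmod (f z))) \<in> Lambda_inf \<omega> G"
  then obtain C where C: "C > 0" and osc: "\<And>z w. z \<in> G \<Longrightarrow> w \<in> G \<Longrightarrow>
      cmod (complex_of_real (cmod (f z)) - complex_of_real (cmod (f w))) \<le> C * d_om \<omega> G z w"
    unfolding Lambda_inf_def by blast
  define K where "K = 16 * C / (1 - k)"
  have K: "K > 0" using C assms(6) by (simp add: K_def)
  have "\<exists>f'. (f has_derivative f') (at z) \<and>
      (\<forall>v. cmod (f' v) \<le> K * (\<omega> (bdist G z) / bdist G z) * norm v)" if "z \<in> G" for z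
    unfolding K_def by (rule derivative_bound_of_abs_Lambda[OF assms(1-3,6,7) C osc that])
  then obtain f' where "\<And>z. z \<in> G \<Longrightarrow> (f has_derivative f' z) (at z)"
      "\<And>z v. z \<in> G \<Longrightarrow> cmod (f' z v) \<le> K * (\<omega> (bdist G z) / bdist G z) * norm v"
    by metis
  then have "cmod (f z\<^sub>1 - f z\<^sub>2) \<le> K * d_om \<omega> G z\<^sub>1 z\<^sub>2" if "z\<^sub>1 \<in> G" "z\<^sub>2 \<in> G" for z\<^sub>1 z\<^sub>2
    using norm_diff_le_d_om_of_derivative[OF assms(1-3) K _ _ that, of f f'] by blast
  then show "f \<in> Lambda_inf \<omega> G"
    unfolding Lambda_inf_def using K by blast
qed

end
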